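(* Let $\mathcal{C} = (E, \mathcal{A}, \pi, \mathit{ok}, \vdash, \Vdash)$ be a contract. If an agreement on $\mathcal{C}$ exists, then for every participant $A \in \mathcal{A}$ and every $X \subseteq E$, either $\mathit{ok}(A, X)$ holds, or some participant is culpable in $X$.
   Context: A contract is a 6-tuple $\mathcal{C} = (E, \mathcal{A}, \pi, \mathit{ok}, \vdash, \Vdash)$ where $E$ is a finite set of events, $\mathcal{A}$ is a finite set of participants, $\pi : E \to \mathcal{A}$ assigns each event to a participant, $\mathit{ok} \subseteq \mathcal{A} \times \mathcal{P}(E)$ (the fulfillment relation) satisfies $\mathit{ok}(A,X) \wedge X \subseteq Y \Rightarrow \mathit{ok}(A,Y)$, and $\vdash, \Vdash \subseteq \mathcal{P}(E) \times E$ (enabling and circular enabling) are saturated: $X \circ e$ and $X \subseteq Y$ imply $Y \circ e$ for $\circ \in \{\vdash, \Vdash\}$. A set $C \subseteq E$ is a configuration of $\mathcal{C}$ iff there exist $e_0, \ldots, e_n$ with $\{e_0,\ldots,e_n\} = C$ such that for every $i \le n$, either $\{e_0,\ldots,e_{i-1}\} \vdash e_i$ or $C \Vdash e_i$. An agreement on $\mathcal{C}$ is a configuration $C$ such that $\mathit{ok}(A, C)$ for all $A \in \mathcal{A}$. For a participant $A$ and a set $X \subseteq E$, $\mathrm{duties}(A, X)$ is the set of events $e \notin X$ with $\pi(e) = A$ for which there exists a configuration $C$ of $\mathcal{C}$ with $e \in C$ such that either $X \vdash e$, or [there is no $e' \in C \setminus X$ with $X \vdash e'$, and there exists $D \subseteq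 C \cup X$ with $D \Vdash e$]. A participant $A$ is culpable in $X$ when $\mathrm{duties}(A,X) \neq \emptyset$. *)

theory Defs
  imports "HOL-Library.FuncSet"
begin

record ('e, 'p) contract_tuple =
  events :: "'e set"
  participants :: "'p set"
  owner :: "'e \<Rightarrow> 'p"
  ok :: "('p \<times> 'e set) set"
  enabling :: "('e set \<times> 'e) set"
  circ_enabling :: "('e set \<times> 'e) set"

abbreviation enables :: "'e set \<Rightarrow> ('e, 'p) contract_tuple \<Rightarrow> 'e \<Rightarrow> bool"
    ("(_/ \<turnstile>\<^bsub>_\<^esub>/ _)" [51, 0, 51] 50)
  where "X \<turnstile>\<^bsub>K\<^esub> e \<equiv> (X, e) \<in> enabling K"

abbreviation circ_enables :: "'e set \<Rightarrow> ('e, 'p) contract_tuple \<Rightarrow> 'e \<Rightarrow> bool"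
    ("(_/ \<tturnstile>\<^bsub>_\<^esub>/ _)" [51, 0, 51] 50)
  where "X \<tturnstile>\<^bsub>K\<^esub> e \<equiv> (X, e) \<in> circ_enabling K"

text \<open>The larger set in monotonicity and saturation ranges over the subsets of the events, because
  the three relations live on the powerset of the events.\<close>

locale contract =
  fixes K :: "('e, 'p) contract_tuple"
  assumes finite_events: "finite (events K)"
    and finite_participants: "finite (participants K)"
    and owner_closed: "owner K \<in> events K \<rightarrow> participants K"
    and ok_subset: "ok K \<subseteq> participants K \<times> Pow (events K)"
    and enabling_subset: "enabling K \<subseteq> Pow (events K) \<times> events K"
    and circ_enabling_subset: "circ_enabling K \<subseteq> Pow (events K) \<times> events K"
    and ok_mono: "\<lbrakk>(A, X) \<in> ok K; X \<subseteq> Y; Y \<subseteq> events K\<rbrakk> \<Longrightarrow> (A, Y) \<in> ok K"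
    and enabling_saturated: "\<lbrakk>X \<turnstile>\<^bsub>K\<^esub> e; X \<subseteq> Y; Y \<subseteq> events K\<rbrakk> \<Longrightarrow> Y \<turnstile>\<^bsub>K\<^esub> e"
    and circ_enabling_saturated: "\<lbrakk>X \<tturnstile>\<^bsub>K\<^esub> e; X \<subseteq> Y; Y \<subseteq> events K\<rbrakk> \<Longrightarrow> Y \<tturnstile>\<^bsub>K\<^esub> e"

text \<open>The enumerating sequence may be empty, so that the empty set is a configuration, as is usual
  for event structures. Repetitions in the sequence are allowed.\<close>

definition configuration :: "('e, 'p) contract_tuple \<Rightarrow> 'e set \<Rightarrow> bool" where
  "configuration K C \<longleftrightarrow> C \<subseteq> events K \<and>
     (\<exists>es. set es = C \<and>
        (\<forall>i < length es. set (take i es) \<turnstile>\<^bsub>K\<^esub> es ! i \<or> C \<tturnstile>\<^bsub>K\<^esub> es ! i))"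

definition agreement :: "('e, 'p) contract_tuple \<Rightarrow> 'e set \<Rightarrow> bool" where
  "agreement K C \<longleftrightarrow> configuration K C \<and> (\<forall>A \<in> participants K. (A, C) \<in> ok K)"

definition duties :: "('e, 'p) contract_tuple \<Rightarrow> 'p \<Rightarrow> 'e set \<Rightarrow> 'e set" where
  "duties K A X = {e \<in> events K. e \<notin> X \<and> owner K e = A \<and>
     (\<exists>C. configuration K C \<and> e \<in> C \<and>
        (X \<turnstile>\<^bsub>K\<^esub> e \<or>
         (\<not> (\<exists>e' \<in> C - X. X \<turnstile>\<^bsub>K\<^esub> e') \<and> (\<exists>D \<subseteq> C \<union> X. D \<tturnstile>\<^bsub>K\<^esub> e))))}"

definition culpable :: "('e, 'p) contract_tuple \<Rightarrow> 'p \<Rightarrow> 'e set \<Rightarrow> bool" where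
  "culpable K A X \<longleftrightarrow> duties K A X \<noteq> {}"

end

theory Submission
  imports Defs
begin

text \<open>Enumerate an agreement \<open>C\<close>. If \<open>C \<subseteq> X\<close>, monotonicity gives \<open>ok\<close> at \<open>X\<close>. Otherwise the first
  event of the enumeration outside \<open>X\<close> has its predecessors in \<open>X\<close>, so by saturation it is either
  enabled by \<open>X\<close> or circularly enabled by \<open>C\<close>. Hence either some event of \<open>C - X\<close> is enabled by \<open>X\<close>,
  and its owner is culpable, or the owner of that first event is.\<close>

lemma (in contract) configuration_exits:
  assumes "configuration K C" and "X \<subseteq> events K" and "\<not> C \<subseteq> X"
  obtains e where "e \<in> C - X" and "X \<turnstile>\<^bsub>K\<^esub> e \<or> C \<tturnstile>\<^bsub>K\<^esub> e"
proof -
  from assms(1) obtain es where es: "set es = C"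
    and en: "\<And>i. i < length es \<Longrightarrow> set (take i es) \<turnstile>\<^bsub>K\<^esub> es ! i \<or> C \<tturnstile>\<^bsub>K\<^esub> es ! i"
    unfolding configuration_def by blast
  from es assms(3) have "\<exists>x \<in> set es. x \<notin> X"
    by blast
  then obtain ys e zs where split: "es = ys @ e # zs" and "e \<notin> X" and "set ys \<subseteq> X"
    by (auto dest!: split_list_first_prop)
  from en[of "length ys"] split have "set ys \<turnstile>\<^bsub>K\<^esub> e \<or> C \<tturnstile>\<^bsub>K\<^esub> e"
    by simp
  \<comment> \<open>Only the first disjunct is lifted, from \<open>set ys\<close> to
    \<open>X\<close>; circular enabling already refers to all of \<open>C\<close>.\<close>
  then have "X \<turnstile>\<^bsub>K\<^esub> e \<or> C \<tturnstile>\<^bsub>K\<^esub> e"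
    using enabling_saturated \<open>set ys \<subseteq> X\<close> assms(2) by blast
  moreover have "e \<in> C - X"
    using split es \<open>e \<notin> X\<close> by auto
  ultimately show thesis
    using that by blast
qed

lemma (in contract) configuration_culpable:
  assumes C: "configuration K C" and "X \<subseteq> events K" and "\<not> C \<subseteq> X"
  shows "\<exists>B \<in> participants K. culpable K B X"
proof -
  have "C \<subseteq> events K"
    using C by (simp add: configuration_def)
  obtain e where e: "e \<in> C - X" "X \<turnstile>\<^bsub>K\<^esub> e \<or> C \<tturnstile>\<^bsub>K\<^esub> e"
    using configuration_exits[OF assms] .
  \<comment> \<open>If \<open>X\<close> enables some event of \<open>C - X\<close>, take it as
    \<open>e'\<close>. Otherwise \<open>e\<close> itself serves: it must be circularly enabled by
    \<open>C\<close>, so \<open>D = C\<close> works.\<close>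
  have "\<exists>e' \<in> C - X. X \<turnstile>\<^bsub>K\<^esub> e' \<or>
      (\<not> (\<exists>e'' \<in> C - X. X \<turnstile>\<^bsub>K\<^esub> e'') \<and> (\<exists>D \<subseteq> C \<union> X. D \<tturnstile>\<^bsub>K\<^esub> e'))"
    using e by blast
  \<comment> \<open>The configuration that \<open>duties\<close> asks for is \<open>C\<close>
    itself.\<close>
  then obtain e' where e': "e' \<in> C - X" and "e' \<in> duties K (owner K e') X"
    using C \<open>C \<subseteq> events K\<close> unfolding duties_def by blast
  moreover have "owner K e' \<in> participants K"
    using owner_closed e' \<open>C \<subseteq> events K\<close> by blast
  ultimately show ?thesis
    unfolding culpable_def by blast
qed

theorem theorem1:
  fixes K :: "('e, 'p) contract_tuple"
  assumes "contract K"
    and "\<exists>C. agreement K C"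
  shows "\<forall>A \<in> participants K. \<forall>X \<subseteq> events K.
           (A, X) \<in> ok K \<or> (\<exists>B \<in> participants K. culpable K B X)"
  using assms contract.ok_mono contract.configuration_culpable
  unfolding agreement_def by metis

end
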